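(* Let $X$ and $Z$ be independent real random variables, where $Z$ has a probability density function $f_Z$, let $\sigma>0$, and let $Y=X+\sigma Z$. Let $g:\mathbb{R}\to\mathbb{R}$ be a measurable function with a well-defined functional inverse $g^{-1}:\mathcal{R}_g\to\mathbb{R}$ that is differentiable, where $\mathcal{R}_g$ denotes the range of $g$, and let $W=X-g(Y)$. Then the probability density function $f_W$ of $W$ is given, for $w\in\mathbb{R}$, by $$f_W(w)=\frac{1}{\sigma}\,\mathbb{E}\left[f_Z\left(\frac{g^{-1}(X-w)-X}{\sigma}\right)\left|\frac{\mathrm{d}\, g^{-1}(X-w)}{\mathrm{d}w}\right|\mathbf{1}_{\mathcal{R}_g}(X-w)\right].$$ Consequently, if $g(Y)=\hat X(Y)$, where $\hat X(y)=\mathbb{E}[X\mid Y=y]$, so that $W = X-\mathbb{E}[X\mid Y]$ (with $\hat X$ having a differentiable functional inverse $\hat X^{-1}:\mathcal{R}_{\hat X}\to\mathbb{R}$ on its range $\mathcal{R}_{\hat X}$), then for $w\in\mathbb{R}$ $$f_W(w)=\frac{1}{\sigma}\,\mathbb{E}\left[f_Z\left(\frac{\hat X^{-1}(X-w)-X}{\sigma}\right)\left|\frac{\mathrm{d}\,\hat X^{-1}(X-w)}{\mathrm{d}w}\right|\mathbf{1}_{\mathcal{R}_{\hat X}}(X-w)\right].$$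
   Context: $\mathbf{1}_A$ is the indicator function of the set $A$; the integrand inside each expectation is understood to be $0$ when the indicator vanishes. The expectation is over $X$ with $w$ fixed. The density $f_W$ is with respect to Lebesgue measure (and hence determined up to Lebesgue-null sets). The conditional expectation is $\mathbb{E}[X\mid Y=y]=\int x\,\mathrm{d}P_{X|Y=y}(x)$, where $P_{X|Y=y}$ is the conditional distribution. *)

theory Defs
  imports "HOL-Probability.Probability"
begin

text \<open>
  The random variable inside the expectation, as a function of the value \<open>x\<close> of \<open>X\<close>.
  Values of \<^term>\<open>inv g\<close> off \<^term>\<open>range g\<close> are arbitrary, but are cancelled by the
  indicator.  As \<open>g\<^sup>-\<^sup>1(x - v)\<close> is only defined for \<open>x - v\<close> in the range of \<open>g\<close>, which need not be
  open, its derivative in \<open>v\<close> is taken relative to that set of \<open>v\<close>.  At isolated points of the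
  set this derivative is an arbitrary constant, which affects only countably many \<open>w\<close> for
  each \<open>x\<close>.
\<close>
definition err_integrand ::
  "(real \<Rightarrow> real) \<Rightarrow> real \<Rightarrow> (real \<Rightarrow> real) \<Rightarrow> real \<Rightarrow> real \<Rightarrow> real" where
  "err_integrand fZ \<sigma> g w x =
     fZ ((inv g (x - w) - x) / \<sigma>)
     * \<bar>vector_derivative (\<lambda>v. inv g (x - v)) (at w within {v. x - v \<in> range g})\<bar>
     * indicator (range g) (x - w)"

text \<open>
  The expectation of a nonnegative variable is taken in \<open>[0, \<infinity>]\<close>, so that the formula is meaningful
  at every \<open>w\<close>, including the exceptional null set where it may be infinite.
\<close>
definition err_density ::
  "'a measure \<Rightarrow> ('a \<Rightarrow> real) \<Rightarrow> (real \<Rightarrow> real) \<Rightarrow> real \<Rightarrow> (real \<Rightarrow> real) \<Rightarrow> real \<Rightarrow> ennreal" where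
  "err_density M X fZ \<sigma> g w =
     ennreal (1 / \<sigma>) * (\<integral>\<^sup>+ \<omega>. ennreal (err_integrand fZ \<sigma> g w (X \<omega>)) \<partial>M)"

text \<open>
  \<open>K y\<close> is a (regular) conditional distribution of \<open>X\<close> given \<open>Y = y\<close>.
\<close>
definition is_cond_distr ::
  "'a measure \<Rightarrow> ('a \<Rightarrow> real) \<Rightarrow> ('a \<Rightarrow> real) \<Rightarrow> (real \<Rightarrow> real measure) \<Rightarrow> bool" where
  "is_cond_distr M X Y K \<longleftrightarrow>
     K \<in> borel \<rightarrow>\<^sub>M prob_algebra borel \<and>
     (\<forall>A\<in>sets borel. \<forall>B\<in>sets borel.
        emeasure M {\<omega> \<in> space M. X \<omega> \<in> A \<and> Y \<omega> \<in> B} =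
        (\<integral>\<^sup>+ y\<in>B. emeasure (K y) A \<partial>distr M borel Y))"

definition cond_mean :: "(real \<Rightarrow> real measure) \<Rightarrow> real \<Rightarrow> real" where
  "cond_mean K y = (\<integral>x. x \<partial>K y)"

end

theory Submission
  imports Defs
begin

text \<open>
  For fixed \<open>X = x\<close>, the substitutions \<open>y = x + \<sigma> z\<close>, \<open>y = g\<^sup>-\<^sup>1(u)\<close> and \<open>u = x - w\<close> turn the law of
  \<open>x - g(x + \<sigma> Z)\<close> into an integral over \<open>w\<close>; independence and Tonelli's theorem then give the
  density.  The delicate point is measurability.  The continuous function \<open>g\<^sup>-\<^sup>1\<close> on the range \<open>R\<close> of
  \<open>g\<close> has a Borel extension \<open>h\<close> to the whole line, so \<open>R = {u. g (h u) = u}\<close> is a Borel set; and the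
  derivative of \<open>g\<^sup>-\<^sup>1\<close> within \<open>R\<close> is the limit of suprema of difference quotients along a
  countable dense subset of \<open>R\<close>.
\<close>

section \<open>Borel extension and the range of an injective function\<close>

text \<open>Extending by zero would require \<open>S\<close> to be Borel, which is exactly what is
  to be proved for the range of \<open>g\<close>. Instead each set where \<open>h\<close> is below
  \<open>q\<close> is the trace on \<open>S\<close> of an open set \<open>B q\<close>, and the
  extension is read off from these open sets.\<close>

lemma continuous_on_imp_borel_extension:
  fixes h :: "'a::topological_space \<Rightarrow> real"
  assumes "continuous_on S h"
  obtains h' where "h' \<in> borel_measurable borel" "\<And>u. u \<in> S \<Longrightarrow> h' u = h u"
proof -
  have "\<exists>B. open B \<and> B \<inter> S = h -` {..<q} \<inter> S" for q
    using assms open_lessThan[of q] by (auto simp: continuous_on_open_invariant)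
  then obtain B where B: "\<And>q. open (B q)" "\<And>q. B q \<inter> S = h -` {..<q} \<inter> S"
    by metis
  have [measurable]: "B q \<in> sets borel" for q
    using B by auto
  \<comment> \<open>On \<open>S\<close> this is the infimum of the rationals above
    \<open>h u\<close>, hence \<open>h u\<close>; the countable index set keeps \<open>e\<close>
    Borel. Off \<open>S\<close> it may be infinite, hence the passage through
    \<open>ereal\<close>.\<close>
  define e where "e u = (INF q\<in>\<rat>. if u \<in> B q then ereal q else \<infinity>)" for u
  have [measurable]: "e \<in> borel_measurable borel"
    unfolding e_def by (intro borel_measurable_INF) (auto simp: countable_rat)
  have "e u = ereal (h u)" if "u \<in> S" for u
  proof (rule antisym)
    have *: "u \<in> B q \<longleftrightarrow> h u < q" for q
      using B(2)[of q] that by auto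
    show "ereal (h u) \<le> e u"
      unfolding e_def by (intro INF_greatest) (auto simp: *)
    show "e u \<le> ereal (h u)"
    proof (rule ereal_le_epsilon2)
      fix r :: real assume "0 < r"
      then obtain q where q: "q \<in> \<rat>" "h u < q" "q < h u + r"
        using Rats_dense_in_real[of "h u" "h u + r"] by auto
      have "e u \<le> (if u \<in> B q then ereal q else \<infinity>)"
        unfolding e_def by (rule INF_lower) (use q in auto)
      also have "\<dots> \<le> ereal (h u) + ereal r"
        using q by (simp add: *)
      finally show "e u \<le> ereal (h u) + ereal r" .
    qed
  qed
  then show thesis
    by (intro that[of "\<lambda>u. real_of_ereal (e u)"]) auto
qed

text \<open>With a Borel extension \<open>h\<close> of \<open>inv g\<close>, the equation
  \<open>g (h u) = u\<close> holds for \<open>u\<close> in the range, and conversely exhibits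
  \<open>u\<close> as a value of \<open>g\<close>.\<close>

lemma borel_range_of_continuous_on_inv:
  fixes g :: "real \<Rightarrow> 'b::{second_countable_topology, t2_space}"
  assumes [measurable]: "g \<in> borel_measurable borel"
    and "inj g" "continuous_on (range g) (inv g)"
  shows "range g \<in> sets borel"
proof -
  obtain h where h [measurable]: "h \<in> borel_measurable borel"
    and eq: "\<And>u. u \<in> range g \<Longrightarrow> h u = inv g u"
    using continuous_on_imp_borel_extension[OF assms(3)] by blast
  have "range g = {u \<in> space borel. g (h u) = u}"
    using eq \<open>inj g\<close> by auto (metis rangeI)
  also have "\<dots> \<in> sets borel"
    by measurable
  finally show ?thesis .
qed

section \<open>Derivatives within a set: measurability and reflection\<close>

text \<open>Every number is a derivative at an isolated point, so \<open>vector_derivative\<close>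
  there is one fixed choice, the same for all functions and points.\<close>

lemma has_vector_derivative_bot: "(f has_vector_derivative D) bot"
  by (simp add: has_vector_derivative_def has_derivative_def bounded_linear_scaleR_left)

text \<open>At a limit point of \<open>S\<close>, the dense set \<open>T\<close> meets every
  punctured neighbourhood, so difference quotients along \<open>T\<close> already determine the
  derivative.\<close>

lemma borel_measurable_vector_derivative_within:
  fixes h :: "real \<Rightarrow> real"
  assumes diff: "h differentiable_on S"
  shows "(\<lambda>u. vector_derivative h (at u within S)) \<in> borel_measurable (restrict_space borel S)"
proof -
  obtain T where T: "countable T" "T \<subseteq> S" "S \<subseteq> closure T"
    by (rule separable)
  define N :: "nat \<Rightarrow> real \<Rightarrow> real set" where "N n u = {r. r \<noteq> u \<and> dist r u < 1 / Suc n}" for n u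
  define Q where "Q r u = (h r - h u) / (r - u)" for r u
  \<comment> \<open>The suprema decrease in \<open>n\<close>, so this is an upper limit. The default
    \<open>-\<infinity>\<close> is neutral in the supremum; it survives as the value of
    \<open>e\<close> exactly at isolated points and thereby marks them.\<close>
  define e where "e u = (INF n. SUP r\<in>T. if r \<in> N n u then ereal (Q r u) else -\<infinity>)" for u
  define c where "c = (SOME D::real. True)"
  have [measurable]: "h \<in> borel_measurable (restrict_space borel S)"
    by (intro borel_measurable_continuous_on_restrict differentiable_imp_continuous_on diff)
  have [measurable]: "(\<lambda>u. u) \<in> borel_measurable (restrict_space borel S)"
    by (intro measurable_restrict_space1) simp
  have [measurable]: "Measurable.pred (restrict_space borel S) (\<lambda>u. r \<in> N n u)" for r n
    unfolding N_def by simp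
  have [measurable]: "e \<in> borel_measurable (restrict_space borel S)"
    unfolding e_def Q_def using T(1)
    by (intro borel_measurable_INF borel_measurable_SUP measurable_If) auto
  have "vector_derivative h (at u within S) = (if e u = -\<infinity> then c else real_of_ereal (e u))"
    if u: "u \<in> S" for u
  proof (cases "at u within S = bot")
    case True
    have "\<exists>d>0. \<forall>r\<in>S. r \<noteq> u \<longrightarrow> \<not> dist r u < d"
      using True by (auto simp: trivial_limit_within islimpt_approachable)
    then obtain d where "d > 0" "\<And>r. r \<in> S \<Longrightarrow> r \<noteq> u \<Longrightarrow> \<not> dist r u < d"
      by auto
    moreover obtain n where "1 / Suc n < d"
      using \<open>d > 0\<close> nat_approx_posE by blast
    ultimately have "r \<notin> N n u" if "r \<in> T" for r
      using that T unfolding N_def by force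
    then have "(SUP r\<in>T. if r \<in> N n u then ereal (Q r u) else -\<infinity>) \<le> -\<infinity>"
      by (intro SUP_least) auto
    then have "e u \<le> -\<infinity>"
      unfolding e_def by (rule INF_lower2[OF UNIV_I])
    then have "e u = -\<infinity>"
      by simp
    then show ?thesis
      using True by (simp add: c_def vector_derivative_def has_vector_derivative_bot)
  next
    case False
    define D where "D = vector_derivative h (at u within S)"
    have "(h has_vector_derivative D) (at u within S)"
      using diff u unfolding D_def differentiable_on_def by (auto simp: vector_derivative_works)
    then have lim: "((\<lambda>r. Q r u) \<longlongrightarrow> D) (at u within S)"
      by (simp add: Q_def flip: has_real_derivative_iff_has_vector_derivative has_field_derivative_iff)
    have close: "\<exists>d>0. \<forall>r\<in>S. r \<noteq> u \<and> dist r u < d \<longrightarrow> \<bar>Q r u - D\<bar> < \<epsilon>" if "\<epsilon> > 0" for \<epsilon>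
      using lim that unfolding Lim_within dist_real_def by fastforce
    have dense: "\<exists>r\<in>T. r \<noteq> u \<and> dist r u < d" if "d > 0" for d
    proof -
      obtain s where s: "s \<in> S" "s \<noteq> u" "dist s u < d"
        using False \<open>d > 0\<close> by (auto simp: trivial_limit_within islimpt_approachable)
      \<comment> \<open>Being closer to \<open>s\<close> than \<open>u\<close> is keeps
        \<open>t\<close> away from \<open>u\<close>; the bound \<open>d - dist s u\<close> keeps it
        within \<open>d\<close> of \<open>u\<close>.\<close>
      then obtain t where "t \<in> T" "dist t s < min (dist s u) (d - dist s u)"
        using T(3) closure_approachable[of s T] by (metis diff_gt_0_iff_gt min_less_iff_conj subsetD zero_less_dist_iff)
      moreover have "dist t u \<le> dist t s + dist s u" "dist s u \<le> dist t s + dist t u"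
        using dist_triangle[of t u s] dist_triangle[of s u t] by (auto simp: dist_commute)
      ultimately show ?thesis
        by (intro bexI[of _ t]) auto
    qed
    have "e u = ereal D"
    \<comment> \<open>For the upper bound one sufficiently large \<open>n\<close> is enough; for the
      lower bound, \<open>dense\<close> supplies one good point of \<open>T\<close> for each
      \<open>n\<close>.\<close>
    proof (rule antisym)
      show "e u \<le> ereal D"
      proof (rule ereal_le_epsilon2)
        fix \<epsilon> :: real assume "0 < \<epsilon>"
        then obtain d where d: "d > 0" "\<And>r. r \<in> S \<Longrightarrow> r \<noteq> u \<Longrightarrow> dist r u < d \<Longrightarrow> \<bar>Q r u - D\<bar> < \<epsilon>"
          using close by blast
        obtain n where n: "1 / Suc n < d"
          using \<open>d > 0\<close> nat_approx_posE by blast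
        have "e u \<le> (SUP r\<in>T. if r \<in> N n u then ereal (Q r u) else -\<infinity>)"
          unfolding e_def by (rule INF_lower) simp
        also have "\<dots> \<le> ereal (D + \<epsilon>)"
        proof (rule SUP_least)
          fix r assume "r \<in> T"
          then show "(if r \<in> N n u then ereal (Q r u) else -\<infinity>) \<le> ereal (D + \<epsilon>)"
            using d(2)[of r] n T(2) by (auto simp: N_def)
        qed
        finally show "e u \<le> ereal D + ereal \<epsilon>"
          by simp
      qed
      show "ereal D \<le> e u"
        unfolding e_def
      proof (rule INF_greatest, rule ereal_le_epsilon2)
        fix n and \<epsilon> :: real assume "0 < \<epsilon>"
        then obtain d where d: "d > 0" "\<And>r. r \<in> S \<Longrightarrow> r \<noteq> u \<Longrightarrow> dist r u < d \<Longrightarrow> \<bar>Q r u - D\<bar> < \<epsilon>"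
          using close by blast
        obtain r where r: "r \<in> T" "r \<noteq> u" "dist r u < min d (1 / Suc n)"
          using dense[of "min d (1 / Suc n)"] \<open>d > 0\<close> by auto
        have "ereal D \<le> ereal (Q r u) + ereal \<epsilon>"
          using d(2)[of r] r T(2) by auto
        also have "ereal (Q r u) = (if r \<in> N n u then ereal (Q r u) else -\<infinity>)"
          using r by (simp add: N_def)
        also have "\<dots> \<le> (SUP r\<in>T. if r \<in> N n u then ereal (Q r u) else -\<infinity>)"
          by (rule SUP_upper) fact
        finally show "ereal D \<le> (SUP r\<in>T. if r \<in> N n u then ereal (Q r u) else -\<infinity>) + ereal \<epsilon>"
          by (simp add: add_right_mono)
      qed
    qed
    then show ?thesis
      by (simp add: D_def)
  qed
  then show ?thesis
    by (subst measurable_cong[where g = "\<lambda>u. if e u = -\<infinity> then c else real_of_ereal (e u)"])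
      (auto simp: space_restrict_space)
qed

text \<open>
  At isolated points both sides are the same arbitrary constant, so no points need to be excluded.
\<close>
lemma abs_vector_derivative_reflect:
  fixes h :: "real \<Rightarrow> real"
  assumes "h differentiable_on S" "x - w \<in> S"
  shows "\<bar>vector_derivative (\<lambda>v. h (x - v)) (at w within {v. x - v \<in> S})\<bar>
       = \<bar>vector_derivative h (at (x - w) within S)\<bar>"
proof -
  let ?S = "{v. x - v \<in> S}"
  have img: "(\<lambda>v. x - v) ` ?S = S"
    by (auto intro!: image_eqI[of _ _ "x - _"])
  \<comment> \<open>The reflection \<open>v \<mapsto> x - v\<close> is an isometry exchanging the
    two sets, so both filters are trivial together.\<close>
  have "w islimpt ?S \<longleftrightarrow> x - w islimpt S"
    unfolding islimpt_approachable dist_real_def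
  proof (intro iff_allI imp_cong refl iffI; elim bexE)
    fix e v assume "v \<in> ?S" "v \<noteq> w \<and> \<bar>v - w\<bar> < e"
    then show "\<exists>u\<in>S. u \<noteq> x - w \<and> \<bar>u - (x - w)\<bar> < e"
      by (intro bexI[of _ "x - v"]) auto
  next
    fix e u assume "u \<in> S" "u \<noteq> x - w \<and> \<bar>u - (x - w)\<bar> < e"
    then show "\<exists>v\<in>?S. v \<noteq> w \<and> \<bar>v - w\<bar> < e"
      by (intro bexI[of _ "x - u"]) auto
  qed
  then have bot: "at w within ?S = bot \<longleftrightarrow> at (x - w) within S = bot"
    by (simp add: trivial_limit_within)
  show ?thesis
  proof (cases "at w within ?S = bot")
    case True
    then show ?thesis
      using bot by (simp add: vector_derivative_def has_vector_derivative_bot)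
  next
    case False
    define D where "D = vector_derivative h (at (x - w) within S)"
    have "(h has_vector_derivative D) (at (x - w) within S)"
      using assms unfolding D_def differentiable_on_def by (auto simp: vector_derivative_works)
    then have "(h \<circ> (\<lambda>v. x - v) has_vector_derivative (-1) *\<^sub>R D) (at w within ?S)"
      by (intro vector_diff_chain_within) (auto simp: img intro!: derivative_eq_intros)
    then have "vector_derivative (\<lambda>v. h (x - v)) (at w within ?S) = - D"
      using False by (intro vector_derivative_within) (auto simp: o_def)
    then show ?thesis
      by (simp add: D_def)
  qed
qed

section \<open>Change of variables for nonnegative integrands\<close>

text \<open>Transfers the substitution rule for absolutely integrable functions to nonnegative
  integrals: both sides equal the integral of \<open>f\<close> over the image of \<open>S\<close>.
  Derivatives within \<open>S\<close> suit a range that may fail to be open.\<close>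

lemma nn_integral_change_of_variables:
  fixes h f :: "real \<Rightarrow> real"
  assumes "S \<in> sets lebesgue"
    and "\<And>u. u \<in> S \<Longrightarrow> (h has_field_derivative h' u) (at u within S)"
    and "inj_on h S"
    and "f absolutely_integrable_on h ` S"
    and "\<And>y. 0 \<le> f y"
  shows "(\<integral>\<^sup>+u. ennreal (\<bar>h' u\<bar> * f (h u)) * indicator S u \<partial>lborel)
       = (\<integral>\<^sup>+y. ennreal (f y) * indicator (h ` S) y \<partial>lborel)"
proof -
  have *: "(\<lambda>u. \<bar>h' u\<bar> * f (h u)) absolutely_integrable_on S"
    "integral S (\<lambda>u. \<bar>h' u\<bar> * f (h u)) = integral (h ` S) f"
    using has_absolute_integral_change_of_variables_1'[of S h h' f "integral (h ` S) f"] assms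
    by auto
  have "(\<integral>\<^sup>+u. ennreal (\<bar>h' u\<bar> * f (h u)) * indicator S u \<partial>lborel) = ennreal (integral (h ` S) f)"
    using * assms(5)
    by (intro nn_integral_has_integral_lebesgue')
      (auto simp: has_integral_iff dest: set_lebesgue_integral_eq_integral(1))
  also have "\<dots> = (\<integral>\<^sup>+y. ennreal (f y) * indicator (h ` S) y \<partial>lborel)"
    using assms(4,5)
    by (intro nn_integral_has_integral_lebesgue'[symmetric])
      (auto simp: has_integral_iff dest: set_lebesgue_integral_eq_integral(1))
  finally show ?thesis .
qed

section \<open>The density of the error\<close>

lemma distributed_estimation_error:
  fixes M :: "'a measure" and X Z :: "'a \<Rightarrow> real" and fZ g :: "real \<Rightarrow> real" and \<sigma> :: real
  assumes M: "prob_space M"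
    and indep: "prob_space.indep_var M borel X borel Z"
    and Z: "distributed M lborel Z (\<lambda>z. ennreal (fZ z))"
    and nonneg: "\<And>z. 0 \<le> fZ z"
    and \<sigma>: "0 < \<sigma>"
    and g [measurable]: "g \<in> borel_measurable borel"
    and inj: "inj g" and diff: "inv g differentiable_on range g"
  shows "distributed M lborel (\<lambda>\<omega>. X \<omega> - g (X \<omega> + \<sigma> * Z \<omega>)) (err_density M X fZ \<sigma> g)"
proof -
  interpret prob_space M by fact
  interpret M_lborel: pair_sigma_finite M lborel ..
  define R where "R = range g"
  define h where "h = inv g"
  define D where "D u = vector_derivative h (at u within R)" for u
  have diff: "h differentiable_on R" and cont: "continuous_on R h"
    using diff differentiable_imp_continuous_on by (auto simp: h_def R_def)
  have gh: "g (h u) = u" if "u \<in> R" for u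
    using that by (simp add: h_def R_def f_inv_into_f)
  have R [measurable]: "R \<in> sets borel"
    using borel_range_of_continuous_on_inv[OF g inj] cont by (simp add: R_def h_def)
  \<comment> \<open>Since \<open>g\<close> is defined everywhere, substituting
    \<open>y = h u\<close> over \<open>R\<close> covers the whole line and loses no mass of
    \<open>Z\<close>.\<close>
  have hR: "h ` R = UNIV"
    using inj by (auto simp: h_def R_def image_iff)
  have [measurable]: "X \<in> borel_measurable M" "Z \<in> borel_measurable M"
    and XZ: "distr M borel X \<Otimes>\<^sub>M distr M borel Z = distr M (borel \<Otimes>\<^sub>M borel) (\<lambda>\<omega>. (X \<omega>, Z \<omega>))"
    using indep by (auto simp: indep_var_distribution_eq)
  have "(\<lambda>z. ennreal (fZ z)) \<in> borel_measurable borel"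
    using Z by (simp add: distributed_def)
  then have [measurable]: "fZ \<in> borel_measurable borel"
    using nonneg measurable_compose[OF _ borel_measurable_enn2real, of "\<lambda>z. ennreal (fZ z)" borel] by simp
  have fZ_int: "integrable lborel fZ"
  proof (rule integrableI_nonneg)
    have "(\<integral>\<^sup>+z. ennreal (fZ z) * indicator UNIV z \<partial>lborel) = emeasure M (Z -` UNIV \<inter> space M)"
      using Z by (subst distributed_emeasure[OF Z]) auto
    then show "(\<integral>\<^sup>+z. ennreal (fZ z) \<partial>lborel) < \<infinity>"
      by (simp add: emeasure_space_1)
  qed (use nonneg in auto)
  have distrZ: "distr M borel Z = density lborel (\<lambda>z. ennreal (fZ z))"
    using Z unfolding distributed_def by (metis distr_cong sets_lborel)
  \<comment> \<open>Now that \<open>R\<close> is Borel, extension by zero makes both factors Borel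
    on the line. The indicator inside \<open>J\<close> makes \<open>F x\<close> vanish off
    \<open>R\<close>, as \<open>err_integrand\<close> does.\<close>
  define H where "H u = indicator R u * h u" for u
  define J where "J u = \<bar>indicator R u * D u\<bar>" for u
  have [measurable]: "H \<in> borel_measurable borel"
    using borel_measurable_continuous_on_indicator[OF R cont] by (simp add: H_def [abs_def])
  have [measurable]: "J \<in> borel_measurable borel"
    using borel_measurable_vector_derivative_within[OF diff]
    unfolding J_def [abs_def] D_def by (subst (asm) borel_measurable_restrict_space_iff) auto
  define F where "F x u = fZ ((H u - x) / \<sigma>) * J u" for x u
  have integrand: "err_integrand fZ \<sigma> g w x = F x (x - w)" for w x
    using abs_vector_derivative_reflect[OF diff, of x w]
    by (auto simp: err_integrand_def F_def H_def J_def D_def h_def R_def indicator_def)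
  have [measurable]: "(\<lambda>(x, u). F x u) \<in> borel_measurable (borel \<Otimes>\<^sub>M borel)"
    unfolding F_def [abs_def] by measurable
  have dens: "err_density M X fZ \<sigma> g = (\<lambda>w. ennreal (1 / \<sigma>) * (\<integral>\<^sup>+\<omega>. ennreal (F (X \<omega>) (X \<omega> - w)) \<partial>M))"
    by (auto simp: err_density_def integrand)
  have [measurable]: "err_density M X fZ \<sigma> g \<in> borel_measurable borel"
    unfolding dens by measurable
  \<comment> \<open>The identity for a fixed value \<open>x\<close> of \<open>X\<close>; the factor
    \<open>1 / \<sigma>\<close> cancels the Jacobian of \<open>y = x + \<sigma> * z\<close>.\<close>
  have inner: "ennreal (1 / \<sigma>) * (\<integral>\<^sup>+w. ennreal (F x (x - w)) * indicator A w \<partial>lborel)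
      = (\<integral>\<^sup>+z. ennreal (fZ z) * indicator A (x - g (x + \<sigma> * z)) \<partial>lborel)"
    if [measurable]: "A \<in> sets borel" for A x
  proof -
    \<comment> \<open>The test set is carried along as a function of \<open>y\<close>: since
      \<open>g (h u) = u\<close>, its indicator becomes that of \<open>x - u \<in> A\<close> after
      substitution. Domination by the rescaled \<open>fZ\<close> gives integrability.\<close>
    let ?f = "\<lambda>y. fZ ((y - x) / \<sigma>) * indicator A (x - g y)"
    have int: "integrable lborel ?f"
    proof (rule Bochner_Integration.integrable_bound)
      show "integrable lborel (\<lambda>y. fZ ((y - x) / \<sigma>))"
        using lborel_integrable_real_affine[OF fZ_int, of "1 / \<sigma>" "- x / \<sigma>"] \<sigma>
        by (simp add: diff_divide_distrib)
    qed (use nonneg in \<open>auto simp: indicator_def\<close>)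
    have "(\<integral>\<^sup>+w. ennreal (F x (x - w)) * indicator A w \<partial>lborel)
        = (\<integral>\<^sup>+u. ennreal (F x u) * indicator A (x - u) \<partial>lborel)"
      by (subst nn_integral_real_affine[where c = "-1" and t = x]) auto
    also have "\<dots> = (\<integral>\<^sup>+u. ennreal (\<bar>D u\<bar> * ?f (h u)) * indicator R u \<partial>lborel)"
      using gh by (intro nn_integral_cong) (auto simp: F_def H_def J_def indicator_def mult.commute)
    also have "\<dots> = (\<integral>\<^sup>+y. ennreal (?f y) * indicator (h ` R) y \<partial>lborel)"
    proof (rule nn_integral_change_of_variables)
      show "(h has_field_derivative D u) (at u within R)" if "u \<in> R" for u
        using diff that unfolding D_def differentiable_on_def
        by (auto simp: has_real_derivative_iff_has_vector_derivative vector_derivative_works)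
      show "inj_on h R"
        by (metis gh inj_onI)
      show "?f absolutely_integrable_on h ` R"
        using int by (simp add: hR set_integrable_def integrable_completion)
    qed (use nonneg in auto)
    also have "\<dots> = ennreal \<sigma> * (\<integral>\<^sup>+z. ennreal (fZ z) * indicator A (x - g (x + \<sigma> * z)) \<partial>lborel)"
    proof -
      have "ennreal (?f (x + \<sigma> * z)) = ennreal (fZ z) * indicator A (x - g (x + \<sigma> * z))" for z
        using \<sigma> by (simp split: split_indicator)
      then show ?thesis
        using \<sigma> by (subst nn_integral_real_affine[where c = \<sigma> and t = x]) (simp_all add: hR)
    qed
    finally show ?thesis
      using \<sigma> by (simp add: mult.assoc[symmetric] flip: ennreal_mult')
  qed
  have "distr M lborel (\<lambda>\<omega>. X \<omega> - g (X \<omega> + \<sigma> * Z \<omega>)) = density lborel (err_density M X fZ \<sigma> g)"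
  proof (rule measure_eqI)
    fix A assume "A \<in> sets (distr M lborel (\<lambda>\<omega>. X \<omega> - g (X \<omega> + \<sigma> * Z \<omega>)))"
    then have A [measurable]: "A \<in> sets borel"
      by simp
    interpret PZ: prob_space "distr M borel Z"
      by (rule prob_space_distr) simp
    have "emeasure (density lborel (err_density M X fZ \<sigma> g)) A
        = (\<integral>\<^sup>+w. (\<integral>\<^sup>+\<omega>. ennreal (1 / \<sigma>) * (ennreal (F (X \<omega>) (X \<omega> - w)) * indicator A w) \<partial>M) \<partial>lborel)"
      by (subst emeasure_density)
        (auto simp: dens nn_integral_cmult nn_integral_multc mult.assoc intro!: nn_integral_cong)
    also have "\<dots> = (\<integral>\<^sup>+\<omega>. (\<integral>\<^sup>+w. ennreal (1 / \<sigma>) * (ennreal (F (X \<omega>) (X \<omega> - w)) * indicator A w) \<partial>lborel) \<partial>M)"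
      by (rule M_lborel.Fubini') measurable
    also have "\<dots> = (\<integral>\<^sup>+\<omega>. (\<integral>\<^sup>+z. ennreal (fZ z) * indicator A (X \<omega> - g (X \<omega> + \<sigma> * z)) \<partial>lborel) \<partial>M)"
      by (subst nn_integral_cmult) (auto simp: inner)
    also have "\<dots> = (\<integral>\<^sup>+\<omega>. (\<integral>\<^sup>+z. indicator A (X \<omega> - g (X \<omega> + \<sigma> * z)) \<partial>distr M borel Z) \<partial>M)"
      unfolding distrZ by (subst nn_integral_density) auto
    also have "\<dots> = (\<integral>\<^sup>+x. (\<integral>\<^sup>+z. indicator A (x - g (x + \<sigma> * z)) \<partial>distr M borel Z) \<partial>distr M borel X)"
      by (subst nn_integral_distr[of X]) auto
    \<comment> \<open>The iterated integral over the marginals is one over their product, which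
      \<open>XZ\<close>, that is independence, identifies with the joint law.\<close>
    also have "\<dots> = (\<integral>\<^sup>+(x, z). indicator A (x - g (x + \<sigma> * z)) \<partial>(distr M borel X \<Otimes>\<^sub>M distr M borel Z))"
      by (subst PZ.nn_integral_fst[symmetric]) auto
    also have "\<dots> = (\<integral>\<^sup>+\<omega>. indicator A (X \<omega> - g (X \<omega> + \<sigma> * Z \<omega>)) \<partial>M)"
      unfolding XZ by (subst nn_integral_distr) auto
    also have "\<dots> = emeasure (distr M lborel (\<lambda>\<omega>. X \<omega> - g (X \<omega> + \<sigma> * Z \<omega>))) A"
      by (subst nn_integral_distr[of "\<lambda>\<omega>. X \<omega> - g (X \<omega> + \<sigma> * Z \<omega>)" M lborel "indicator A", symmetric]) auto
    finally show "emeasure (distr M lborel (\<lambda>\<omega>. X \<omega> - g (X \<omega> + \<sigma> * Z \<omega>))) A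
        = emeasure (density lborel (err_density M X fZ \<sigma> g)) A"
      by simp
  qed simp
  then show ?thesis
    by (simp add: distributed_def)
qed

section \<open>The conditional mean as estimator\<close>

lemma borel_measurable_cond_mean:
  assumes "K \<in> borel \<rightarrow>\<^sub>M prob_algebra borel"
  shows "cond_mean K \<in> borel_measurable borel"
  using measurable_prob_algebraD[OF assms]
  unfolding cond_mean_def [abs_def] by measurable

theorem theorem1:
  fixes M :: "'a measure" and X Y Z :: "'a \<Rightarrow> real" and fZ :: "real \<Rightarrow> real" and \<sigma> :: real
  assumes "prob_space M"
    and "prob_space.indep_var M borel X borel Z"
    and "distributed M lborel Z (\<lambda>z. ennreal (fZ z))"
    and "\<And>z. 0 \<le> fZ z"
    and "0 < \<sigma>"
    and "Y = (\<lambda>\<omega>. X \<omega> + \<sigma> * Z \<omega>)"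
  shows "(\<forall>g :: real \<Rightarrow> real.
            g \<in> borel_measurable borel \<longrightarrow> inj g \<longrightarrow> inv g differentiable_on range g \<longrightarrow>
            distributed M lborel (\<lambda>\<omega>. X \<omega> - g (Y \<omega>)) (err_density M X fZ \<sigma> g))
       \<and> (\<forall>(K :: real \<Rightarrow> real measure) Xhat.
            is_cond_distr M X Y K \<longrightarrow> (\<forall>y. integrable (K y) (\<lambda>x. x)) \<longrightarrow> Xhat = cond_mean K \<longrightarrow>
            inj Xhat \<longrightarrow> inv Xhat differentiable_on range Xhat \<longrightarrow>
            distributed M lborel (\<lambda>\<omega>. X \<omega> - Xhat (Y \<omega>)) (err_density M X fZ \<sigma> Xhat))"
  \<comment> \<open>The second claim is the first at \<open>g = cond_mean K\<close>, whose
    measurability comes from \<open>K\<close> being a probability kernel.\<close>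
  using distributed_estimation_error[OF assms(1-5)] borel_measurable_cond_mean
  by (auto simp: assms(6) is_cond_distr_def)

end
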